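(* Let $S$ be a finite non-empty set and let $p:2^S\to\mathbb{Z}\cup\{-\infty\}$ be an integer-valued supermodular function with $p(\emptyset)=0$ and $p(S)>-\infty$. The essential value-sequence, the canonical chain and the canonical partition of $p$ (as defined iteratively in the context) coincide with the objects obtained as follows. For each integer $\beta$ let $L(\beta)$ be the smallest maximizer of $p(X)-\beta|X|$ over $X\subseteq S$. There are finitely many integers $\beta$ for which $L(\beta)\ne L(\beta-1)$; denote them by $\beta_1>\beta_2>\cdots>\beta_q$ (this is the essential value-sequence). Define $C_j:=L(\beta_j-1)$ for $j=1,\dots,q$; this gives a chain $C_1\subset C_2\subset\cdots\subset C_q$ (this is the canonical chain). Finally, with $C_0:=\emptyset$, define $$S_j:=C_j-C_{j-1}=L(\beta_j-1)-L(\beta_j)\qquad(j=1,2,\dots,q),$$ which gives a partition $\{S_1,\dots,S_q\}$ of $S$ (this is the canonical partition).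
   Context: A set-function $p$ on $S$ with $p(\emptyset)=0$ (value $-\infty$ allowed) is supermodular if $p(X)+p(Y)\le p(X\cap Y)+p(X\cup Y)$ for all $X,Y\subseteq S$ with finite $p$-values. For each $\beta$ the family of maximizers of $p(X)-\beta|X|$ is closed under union and intersection, so a smallest maximizer exists. Iterative definition. Put $C_0:=\emptyset$ and, for $j=1,2,\dots$, with $\overline{C_{j-1}}:=S-C_{j-1}$, $\beta_j:=\max\{\lceil (p(X\cup C_{j-1})-p(C_{j-1}))/|X|\rceil:\emptyset\ne X\subseteq\overline{C_{j-1}}\}$, $h_j(X):=p(X\cup C_{j-1})-(\beta_j-1)|X|-p(C_{j-1})$ for $X\subseteq\overline{C_{j-1}}$, $S_j:=$ the smallest subset of $\overline{C_{j-1}}$ maximizing $h_j$, $C_j:=C_{j-1}\cup S_j$, stopping at the index $q$ with $C_{q-1}\ne S$, $C_q=S$. The sequence $\beta_1,\dots,\beta_q$ is the essential value-sequence, $C_1\subset\cdots\subset C_q$ is the canonical chain, and $\{S_1,\dots,S_q\}$ is the canonical partition. *)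

theory Defs
  imports "HOL-Library.Extended_Real" "HOL-Library.Disjoint_Sets"
begin

definition supermodular_on :: "'a set \<Rightarrow> ('a set \<Rightarrow> ereal) \<Rightarrow> bool" where
  "supermodular_on S p \<longleftrightarrow>
     (\<forall>X\<subseteq>S. \<forall>Y\<subseteq>S. \<bar>p X\<bar> \<noteq> \<infinity> \<longrightarrow> \<bar>p Y\<bar> \<noteq> \<infinity> \<longrightarrow> p X + p Y \<le> p (X \<inter> Y) + p (X \<union> Y))"

text \<open>The order on sets is inclusion, so \<open>LEAST\<close> picks the maximizer contained in all others;
  its existence for the functions used below is shown in \<open>L_smallest_maximizer\<close> and
  \<open>h_smallest_maximizer\<close>.\<close>

definition smallest_maximizer :: "'a set \<Rightarrow> ('a set \<Rightarrow> ereal) \<Rightarrow> 'a set" where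
  "smallest_maximizer U f = (LEAST Z. is_arg_max f (\<lambda>X. X \<subseteq> U) Z)"


subsection \<open>Iterative definition\<close>

text \<open>The parameter \<open>C\<close> plays the role of $C_{j-1}$. Sets with \<open>p (X \<union> C) = - \<infinity>\<close> contribute
  \<open>- \<infinity>\<close> to the maximum and are left out; \<open>X = S - C\<close> always remains when \<open>C \<noteq> S\<close>
  and \<open>p S\<close> is finite.\<close>

definition step_value :: "'a set \<Rightarrow> ('a set \<Rightarrow> ereal) \<Rightarrow> 'a set \<Rightarrow> int" where
  "step_value S p C =
     Max {\<lceil>real_of_ereal (p (X \<union> C) - p C) / real (card X)\<rceil> | X.
            X \<noteq> {} \<and> X \<subseteq> S - C \<and> p (X \<union> C) \<noteq> - \<infinity>}"

definition step_h :: "'a set \<Rightarrow> ('a set \<Rightarrow> ereal) \<Rightarrow> 'a set \<Rightarrow> 'a set \<Rightarrow> ereal" where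
  "step_h S p C X =
     p (X \<union> C) - ereal (of_int ((step_value S p C - 1) * int (card X))) - p C"

definition step_part :: "'a set \<Rightarrow> ('a set \<Rightarrow> ereal) \<Rightarrow> 'a set \<Rightarrow> 'a set" where
  "step_part S p C = smallest_maximizer (S - C) (step_h S p C)"

primrec canonical_set :: "'a set \<Rightarrow> ('a set \<Rightarrow> ereal) \<Rightarrow> nat \<Rightarrow> 'a set" where
  "canonical_set S p 0 = {}"
| "canonical_set S p (Suc j) = canonical_set S p j \<union> step_part S p (canonical_set S p j)"

text \<open>The next two functions are meaningful for indices from 1 up to the stopping index.\<close>

definition essential_value :: "'a set \<Rightarrow> ('a set \<Rightarrow> ereal) \<Rightarrow> nat \<Rightarrow> int" where
  "essential_value S p j = step_value S p (canonical_set S p (j - 1))"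

definition canonical_part :: "'a set \<Rightarrow> ('a set \<Rightarrow> ereal) \<Rightarrow> nat \<Rightarrow> 'a set" where
  "canonical_part S p j = step_part S p (canonical_set S p (j - 1))"

definition stopping_index :: "'a set \<Rightarrow> ('a set \<Rightarrow> ereal) \<Rightarrow> nat \<Rightarrow> bool" where
  "stopping_index S p q \<longleftrightarrow>
     1 \<le> q \<and> canonical_set S p (q - 1) \<noteq> S \<and> canonical_set S p q = S"


subsection \<open>Definition by the smallest maximizers $L(\beta)$\<close>

definition L :: "'a set \<Rightarrow> ('a set \<Rightarrow> ereal) \<Rightarrow> int \<Rightarrow> 'a set" where
  "L S p \<beta> = smallest_maximizer S (\<lambda>X. p X - ereal (of_int (\<beta> * int (card X))))"

definition jump_values :: "'a set \<Rightarrow> ('a set \<Rightarrow> ereal) \<Rightarrow> int set" where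
  "jump_values S p = {\<beta>. L S p \<beta> \<noteq> L S p (\<beta> - 1)}"

text \<open>Decreasing enumeration, with indices starting at 1.\<close>

definition jump_value :: "'a set \<Rightarrow> ('a set \<Rightarrow> ereal) \<Rightarrow> nat \<Rightarrow> int" where
  "jump_value S p j = rev (sorted_list_of_set (jump_values S p)) ! (j - 1)"

definition jump_set :: "'a set \<Rightarrow> ('a set \<Rightarrow> ereal) \<Rightarrow> nat \<Rightarrow> 'a set" where
  "jump_set S p j = (if j = 0 then {} else L S p (jump_value S p j - 1))"

definition jump_part :: "'a set \<Rightarrow> ('a set \<Rightarrow> ereal) \<Rightarrow> nat \<Rightarrow> 'a set" where
  "jump_part S p j = jump_set S p j - jump_set S p (j - 1)"


subsection \<open>Existence of the smallest maximizers\<close>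

lemma smallest_maximizer_exists:
  fixes f :: "'a set \<Rightarrow> ereal"
  assumes fin: "finite U"
    and ub: "\<And>X. X \<subseteq> U \<Longrightarrow> f X \<noteq> \<infinity>"
    and empty: "f {} \<noteq> - \<infinity>"
    and sm: "supermodular_on U f"
  shows "is_arg_max f (\<lambda>X. X \<subseteq> U) (smallest_maximizer U f)"
    and "is_arg_max f (\<lambda>X. X \<subseteq> U) Z \<Longrightarrow> smallest_maximizer U f \<subseteq> Z"
proof -
  let ?M = "{X. is_arg_max f (\<lambda>X. X \<subseteq> U) X}"
  have M_iff: "X \<in> ?M \<longleftrightarrow> X \<subseteq> U \<and> (\<forall>Y\<subseteq>U. f Y \<le> f X)" for X
    by (auto simp: is_arg_max_def not_less)
  have M_sub: "?M \<subseteq> Pow U" by (auto simp: is_arg_max_def)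
  have finM: "finite ?M" using finite_subset[OF M_sub] fin by simp
  have "Max (f ` Pow U) \<in> f ` Pow U" using fin by (intro Max_in) auto
  then obtain X0 where X0: "X0 \<subseteq> U" "f X0 = Max (f ` Pow U)" by auto
  have "f Y \<le> f X0" if "Y \<subseteq> U" for Y using X0 fin that by simp
  then have neM: "?M \<noteq> {}" using X0(1) by (auto simp only: M_iff empty_iff set_eq_iff)
  have fin_val: "\<bar>f X\<bar> \<noteq> \<infinity>" if "X \<in> ?M" for X
  proof -
    have "X \<subseteq> U" "f {} \<le> f X" using that by (auto simp only: M_iff)
    then show ?thesis using ub[of X] empty by (cases "f X") auto
  qed
  have inter: "X \<inter> Y \<in> ?M" if "X \<in> ?M" "Y \<in> ?M" for X Y
  proof -
    have XY: "X \<subseteq> U" "Y \<subseteq> U" using that by (auto simp only: M_iff)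
    have le: "f Z \<le> f X" if "Z \<subseteq> U" for Z using \<open>X \<in> ?M\<close> that by (simp only: M_iff)
    have eq: "f Y = f X" using that XY by (intro antisym) (simp_all only: M_iff)
    have "f X + f Y \<le> f (X \<inter> Y) + f (X \<union> Y)"
      using sm XY fin_val[OF that(1)] fin_val[OF that(2)] unfolding supermodular_on_def by simp
    moreover have "f (X \<union> Y) \<le> f X" "f (X \<inter> Y) \<le> f X"
      using XY by (auto intro!: le)
    ultimately have "f X \<le> f (X \<inter> Y)"
      using fin_val[OF that(1)] eq
      by (cases "f X"; cases "f (X \<inter> Y)"; cases "f (X \<union> Y)") auto
    then have "\<forall>Z\<subseteq>U. f Z \<le> f (X \<inter> Y)" using le order_trans by blast
    then show ?thesis using XY(1) by (simp only: M_iff) blast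
  qed
  have "\<Inter>A \<in> ?M" if "finite A" "A \<noteq> {}" "A \<subseteq> ?M" for A
    using that by (induction rule: finite_ne_induct) (use inter in auto)
  then have least: "is_arg_max f (\<lambda>X. X \<subseteq> U) (\<Inter>?M)" using finM neM by blast
  have "smallest_maximizer U f = \<Inter>?M"
    unfolding smallest_maximizer_def by (rule Least_equality) (use least in auto)
  then show "is_arg_max f (\<lambda>X. X \<subseteq> U) (smallest_maximizer U f)"
    and "is_arg_max f (\<lambda>X. X \<subseteq> U) Z \<Longrightarrow> smallest_maximizer U f \<subseteq> Z"
    using least by auto
qed

lemma supermodular_on_shift:
  fixes p :: "'a set \<Rightarrow> ereal" and \<beta> :: int
  assumes fin: "finite S" and sm: "supermodular_on S p"
    and ub: "\<And>X. X \<subseteq> S \<Longrightarrow> p X \<noteq> \<infinity>"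
    and C: "C \<subseteq> S" "\<bar>p C\<bar> \<noteq> \<infinity>"
  shows "supermodular_on (S - C) (\<lambda>X. p (X \<union> C) - ereal (of_int (\<beta> * int (card X))) - p C)"
  unfolding supermodular_on_def
proof (intro allI impI)
  let ?h = "\<lambda>X. p (X \<union> C) - ereal (of_int (\<beta> * int (card X))) - p C"
  fix X Y assume XY: "X \<subseteq> S - C" "Y \<subseteq> S - C" and fv: "\<bar>?h X\<bar> \<noteq> \<infinity>" "\<bar>?h Y\<bar> \<noteq> \<infinity>"
  have card: "int (card (X \<union> Y)) = int (card X) + int (card Y) - int (card (X \<inter> Y))"
    using card_Un_Int[of X Y] finite_subset[of _ "S - C"] XY fin by simp
  have sub: "X \<union> C \<subseteq> S" "Y \<union> C \<subseteq> S" "(X \<inter> Y) \<union> C \<subseteq> S" "(X \<union> Y) \<union> C \<subseteq> S" using XY C by auto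
  have eqs: "(X \<union> C) \<inter> (Y \<union> C) = (X \<inter> Y) \<union> C" "(X \<union> C) \<union> (Y \<union> C) = (X \<union> Y) \<union> C" by auto
  have "\<bar>p (X \<union> C)\<bar> \<noteq> \<infinity>" using fv(1) C(2) by (cases "p (X \<union> C)"; cases "p C") simp_all
  moreover have "\<bar>p (Y \<union> C)\<bar> \<noteq> \<infinity>"
    using fv(2) C(2) by (cases "p (Y \<union> C)"; cases "p C") simp_all
  ultimately have fp: "\<bar>p (X \<union> C)\<bar> \<noteq> \<infinity>" "\<bar>p (Y \<union> C)\<bar> \<noteq> \<infinity>" by simp_all
  from fp have ineq: "p (X \<union> C) + p (Y \<union> C) \<le> p ((X \<inter> Y) \<union> C) + p ((X \<union> Y) \<union> C)"
    using sm sub unfolding supermodular_on_def eqs[symmetric] by simp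
  obtain x y c where xyc: "p (X \<union> C) = ereal x" "p (Y \<union> C) = ereal y" "p C = ereal c"
    using fp C(2) by (cases "p (X \<union> C)"; cases "p (Y \<union> C)"; cases "p C") simp_all
  obtain i u where iu: "p ((X \<inter> Y) \<union> C) = ereal i" "p ((X \<union> Y) \<union> C) = ereal u"
    using ineq ub[OF sub(3)] ub[OF sub(4)] unfolding xyc
    by (cases "p ((X \<inter> Y) \<union> C)"; cases "p ((X \<union> Y) \<union> C)") simp_all
  have "x + y \<le> i + u" using ineq unfolding xyc iu by simp
  then show "?h X + ?h Y \<le> ?h (X \<inter> Y) + ?h (X \<union> Y)"
    unfolding xyc iu card by (simp add: algebra_simps)
qed

lemma h_smallest_maximizer:
  fixes p :: "'a set \<Rightarrow> ereal"
  assumes "finite S" "supermodular_on S p" "\<And>X. X \<subseteq> S \<Longrightarrow> p X \<noteq> \<infinity>"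
    and "C \<subseteq> S" "\<bar>p C\<bar> \<noteq> \<infinity>"
  shows "is_arg_max (step_h S p C) (\<lambda>X. X \<subseteq> S - C) (step_part S p C)"
    and "is_arg_max (step_h S p C) (\<lambda>X. X \<subseteq> S - C) Z \<Longrightarrow> step_part S p C \<subseteq> Z"
proof -
  have sm: "supermodular_on (S - C) (step_h S p C)"
    unfolding step_h_def[abs_def] by (rule supermodular_on_shift[OF assms])
  have ub: "step_h S p C X \<noteq> \<infinity>" if "X \<subseteq> S - C" for X
    using assms(3)[of "X \<union> C"] that assms(4,5)
    by (cases "p C"; cases "p (X \<union> C)") (auto simp: step_h_def)
  have e: "step_h S p C {} \<noteq> - \<infinity>" using assms(5) by (cases "p C") (auto simp: step_h_def)
  have f: "finite (S - C)" using assms(1) by simp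
  show "is_arg_max (step_h S p C) (\<lambda>X. X \<subseteq> S - C) (step_part S p C)"
    and "is_arg_max (step_h S p C) (\<lambda>X. X \<subseteq> S - C) Z \<Longrightarrow> step_part S p C \<subseteq> Z"
    unfolding step_part_def using smallest_maximizer_exists[OF f ub e sm] by auto
qed

lemma L_smallest_maximizer:
  fixes p :: "'a set \<Rightarrow> ereal" and \<beta> :: int
  assumes "finite S" "supermodular_on S p" "\<And>X. X \<subseteq> S \<Longrightarrow> p X \<noteq> \<infinity>" "p {} = 0"
  defines "f \<equiv> \<lambda>X. p X - ereal (of_int (\<beta> * int (card X)))"
  shows "is_arg_max f (\<lambda>X. X \<subseteq> S) (L S p \<beta>)"
    and "is_arg_max f (\<lambda>X. X \<subseteq> S) Z \<Longrightarrow> L S p \<beta> \<subseteq> Z"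
proof -
  have sm: "supermodular_on S f"
    using supermodular_on_shift[OF assms(1-3), of "{}" \<beta>] assms(4) by (simp add: f_def)
  have ub: "f X \<noteq> \<infinity>" if "X \<subseteq> S" for X
    using assms(3)[OF that] by (cases "p X") (auto simp: f_def)
  have e: "f {} \<noteq> - \<infinity>" using assms(4) by (simp add: f_def)
  have eq: "L S p \<beta> = smallest_maximizer S f" by (simp add: L_def f_def)
  show "is_arg_max f (\<lambda>X. X \<subseteq> S) (L S p \<beta>)"
    and "is_arg_max f (\<lambda>X. X \<subseteq> S) Z \<Longrightarrow> L S p \<beta> \<subseteq> Z"
    unfolding eq using smallest_maximizer_exists[OF assms(1) ub e sm] by auto
qed

end

theory Submission
  imports Defs
begin

text \<open>
  The two constructions agree because \<open>L\<close> can be read off from the iteration one step at a time.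
  Supermodularity makes \<open>L\<close> antitone in \<open>\<beta>\<close>, so as \<open>\<beta>\<close> decreases the sets \<open>L \<beta>\<close> form a
  growing chain that changes exactly at the jump values. Suppose that a set \<open>C\<close> is known to lie
  in \<open>L \<gamma>\<close>. Then \<open>L \<gamma>\<close> is also the smallest maximizer among the supersets of \<open>C\<close>, and this
  restricted problem is the one that a step of the iteration looks at:

  \<^item> \<open>L \<gamma> = C\<close> says that no superset \<open>X \<union> C\<close> has a larger value of \<open>p - \<gamma> card\<close> than \<open>C\<close>, i.e. that
    every quotient \<open>(p (X \<union> C) - p C) / card X\<close> is at most \<open>\<gamma>\<close>. As \<open>\<gamma>\<close> is an integer, rounding the
    quotients up makes no difference, so this means that \<open>step_value S p C \<le> \<gamma>\<close>
    (\<open>L_eq_iff_step_value_le\<close>).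
  \<^item> At \<open>\<gamma> = step_value S p C - 1\<close> the restricted problem is that of maximizing \<open>step_h S p C\<close>, so
    \<open>L \<gamma> = C \<union> step_part S p C\<close> (\<open>L_eq_step\<close>).

  If \<open>C = L \<beta>\<close> for a jump value \<open>\<beta>\<close>, then \<open>L \<beta> = C \<noteq> L (\<beta> - 1)\<close> and the first fact force
  \<open>step_value S p C = \<beta>\<close>, and the second one makes \<open>L (\<beta> - 1)\<close> the next set of the canonical chain.
  Since \<open>L\<close> is constant between consecutive jump values, \<open>L (\<beta> - 1)\<close> is \<open>L\<close> of the next jump value,
  and an induction along the jump values goes through. The first fact also handles both ends: for
  \<open>C = {}\<close> it shows that \<open>L\<close> is empty from the largest jump value on, and for \<open>C \<noteq> S\<close> it yields a
  further jump value below, so the chain can only end at \<open>S\<close>.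
\<close>

section \<open>Decreasing enumeration of the jump values\<close>

context
  fixes S :: "'a set" and p :: "'a set \<Rightarrow> ereal"
  assumes finite_jumps: "finite (jump_values S p)"
begin

lemma jump_value_strict_antimono:
  assumes "1 \<le> i" "i < j" "j \<le> card (jump_values S p)"
  shows "jump_value S p j < jump_value S p i"
proof -
  have "sorted_wrt (\<lambda>x y. y < x) (rev (sorted_list_of_set (jump_values S p)))"
    by (simp add: sorted_wrt_rev)
  then show ?thesis
    unfolding jump_value_def by (rule sorted_wrt_nth_less) (use assms in auto)
qed

lemma jump_value_image: "jump_value S p ` {1..card (jump_values S p)} = jump_values S p"
proof -
  let ?xs = "rev (sorted_list_of_set (jump_values S p))"
  have "jump_values S p = (!) ?xs ` {..<length ?xs}"
    using set_conv_nth[of ?xs] finite_jumps by auto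
  also have "\<dots> = jump_value S p ` Suc ` {..<card (jump_values S p)}"
    by (simp add: jump_value_def image_image)
  also have "Suc ` {..<card (jump_values S p)} = {1..card (jump_values S p)}"
    by (simp add: image_Suc_lessThan)
  finally show ?thesis by (rule sym)
qed

lemma jump_value_in: "1 \<le> j \<Longrightarrow> j \<le> card (jump_values S p) \<Longrightarrow> jump_value S p j \<in> jump_values S p"
  using jump_value_image by auto

lemma jump_value_exhaust:
  assumes "\<beta> \<in> jump_values S p"
  obtains i where "1 \<le> i" "i \<le> card (jump_values S p)" "\<beta> = jump_value S p i"
proof -
  have "\<beta> \<in> jump_value S p ` {1..card (jump_values S p)}"
    unfolding jump_value_image by (rule assms)
  then show thesis using that by auto
qed

lemma jump_value_gap:
  assumes "1 \<le> j" "j < card (jump_values S p)" and \<beta>: "\<beta> \<in> jump_values S p"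
  shows "\<beta> \<le> jump_value S p (Suc j) \<or> jump_value S p j \<le> \<beta>"
proof -
  obtain i where i: "1 \<le> i" "i \<le> card (jump_values S p)" "\<beta> = jump_value S p i"
    using \<beta> by (rule jump_value_exhaust)
  consider "i < j" | "i = j" | "i = Suc j" | "Suc j < i" by linarith
  then show ?thesis
    using i assms jump_value_strict_antimono[of i j] jump_value_strict_antimono[of "Suc j" i]
    by cases auto
qed

lemma jump_value_le_first:
  assumes "\<beta> \<in> jump_values S p"
  shows "\<beta> \<le> jump_value S p 1"
proof -
  obtain i where i: "1 \<le> i" "i \<le> card (jump_values S p)" "\<beta> = jump_value S p i"
    using assms by (rule jump_value_exhaust)
  then show ?thesis using jump_value_strict_antimono[of 1 i] by (cases "i = 1") auto
qed

lemma jump_value_last_le: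
  assumes "\<beta> \<in> jump_values S p"
  shows "jump_value S p (card (jump_values S p)) \<le> \<beta>"
proof -
  obtain i where i: "1 \<le> i" "i \<le> card (jump_values S p)" "\<beta> = jump_value S p i"
    using assms by (rule jump_value_exhaust)
  then show ?thesis
    using jump_value_strict_antimono[of i "card (jump_values S p)"]
    by (cases "i = card (jump_values S p)") auto
qed

end

lemma L_eq_if_no_jump:
  assumes "\<gamma>' \<le> \<gamma>" and "\<And>\<beta>. \<gamma>' < \<beta> \<Longrightarrow> \<beta> \<le> \<gamma> \<Longrightarrow> \<beta> \<notin> jump_values S p"
  shows "L S p \<gamma>' = L S p \<gamma>"
  using assms
proof (induction \<gamma> rule: int_ge_induct)
  case base
  show ?case by simp
next
  case (step i)
  have "L S p (i + 1) = L S p i"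
    using step.prems[of "i + 1"] step.hyps by (simp add: jump_values_def)
  moreover have "L S p \<gamma>' = L S p i" using step.prems by (intro step.IH) auto
  ultimately show ?case by simp
qed

section \<open>Smallest maximizers in terms of integers\<close>

locale integer_supermodular =
  fixes S :: "'a set" and p :: "'a set \<Rightarrow> ereal"
  assumes finite_ground: "finite S"
    and integer_valued: "\<And>X. X \<subseteq> S \<Longrightarrow> p X = - \<infinity> \<or> (\<exists>k::int. p X = ereal (of_int k))"
    and supermodular: "supermodular_on S p"
    and p_empty: "p {} = 0" and p_ground: "p S > - \<infinity>"
begin

definition feasible :: "'a set \<Rightarrow> bool" where
  "feasible X \<longleftrightarrow> X \<subseteq> S \<and> p X \<noteq> - \<infinity>"

text \<open>On feasible sets \<open>p\<close> is an integer, so the floor only changes the type.\<close>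

definition val :: "'a set \<Rightarrow> int" where
  "val X = \<lfloor>real_of_ereal (p X)\<rfloor>"

definition gain :: "int \<Rightarrow> 'a set \<Rightarrow> int" where
  "gain \<gamma> X = val X - \<gamma> * int (card X)"

lemma p_eq_val: "feasible X \<Longrightarrow> p X = ereal (of_int (val X))"
  using integer_valued[of X] by (auto simp: feasible_def val_def)

lemma p_not_infinity: "X \<subseteq> S \<Longrightarrow> p X \<noteq> \<infinity>"
  using integer_valued[of X] by auto

lemma p_infeasible: "X \<subseteq> S \<Longrightarrow> \<not> feasible X \<Longrightarrow> p X = - \<infinity>"
  by (simp add: feasible_def)

lemma feasible_subset: "feasible X \<Longrightarrow> X \<subseteq> S"
  by (simp add: feasible_def)

lemma feasible_finite: "feasible X \<Longrightarrow> finite X"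
  using finite_ground finite_subset by (auto simp: feasible_def)

lemma feasible_empty: "feasible {}"
  by (simp add: feasible_def p_empty)

lemma feasible_ground: "feasible S"
  using p_ground by (simp add: feasible_def)

lemma supermodular_val:
  assumes X: "feasible X" and Y: "feasible Y"
  shows "feasible (X \<inter> Y)" "feasible (X \<union> Y)" "val X + val Y \<le> val (X \<inter> Y) + val (X \<union> Y)"
proof -
  have sub: "X \<subseteq> S" "Y \<subseteq> S" "X \<inter> Y \<subseteq> S" "X \<union> Y \<subseteq> S"
    using X Y by (auto simp: feasible_def)
  have le: "p X + p Y \<le> p (X \<inter> Y) + p (X \<union> Y)"
    using supermodular[unfolded supermodular_on_def, rule_format, OF sub(1,2)]
    by (simp add: p_eq_val[OF X] p_eq_val[OF Y])
  show fI: "feasible (X \<inter> Y)"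
    using le p_eq_val[OF X] p_eq_val[OF Y] p_not_infinity[OF sub(4)] sub(3)
    by (cases "p (X \<union> Y)") (auto simp: feasible_def)
  show fU: "feasible (X \<union> Y)"
    using le p_eq_val[OF X] p_eq_val[OF Y] p_eq_val[OF fI] sub(4) by (auto simp: feasible_def)
  have "real_of_int (val X + val Y) \<le> real_of_int (val (X \<inter> Y) + val (X \<union> Y))"
    using le by (simp add: p_eq_val X Y fI fU)
  then show "val X + val Y \<le> val (X \<inter> Y) + val (X \<union> Y)" by linarith
qed

lemma ereal_gain:
  "feasible X \<Longrightarrow> p X - ereal (of_int (\<gamma> * int (card X))) = ereal (of_int (gain \<gamma> X))"
  by (simp add: p_eq_val gain_def)

lemma is_arg_max_iff_gain:
  "is_arg_max (\<lambda>X. p X - ereal (of_int (\<gamma> * int (card X)))) (\<lambda>X. X \<subseteq> S) Z \<longleftrightarrow>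
     feasible Z \<and> (\<forall>Y. feasible Y \<longrightarrow> gain \<gamma> Y \<le> gain \<gamma> Z)" (is "?max \<longleftrightarrow> ?gain")
proof
  assume m: ?max
  let ?f = "\<lambda>X. p X - ereal (of_int (\<gamma> * int (card X)))"
  have le: "?f Y \<le> ?f Z" if "Y \<subseteq> S" for Y
    using m that unfolding is_arg_max_linorder by blast
  have "?f {} \<le> ?f Z" by (rule le) simp
  then have Z: "feasible Z" using m by (auto simp: feasible_def is_arg_max_def p_empty)
  have "gain \<gamma> Y \<le> gain \<gamma> Z" if "feasible Y" for Y
    using le[OF feasible_subset[OF that]] unfolding ereal_gain[OF that] ereal_gain[OF Z] by simp
  with Z show ?gain by blast
next
  assume g: ?gain
  then have Z: "feasible Z" by blast
  have "p Y - ereal (of_int (\<gamma> * int (card Y))) \<le> p Z - ereal (of_int (\<gamma> * int (card Z)))"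
    if "Y \<subseteq> S" for Y
  proof (cases "feasible Y")
    case True
    then show ?thesis using g unfolding ereal_gain[OF True] ereal_gain[OF Z] by simp
  next
    case False
    then show ?thesis using that by (simp add: p_infeasible)
  qed
  then show ?max using feasible_subset[OF Z] unfolding is_arg_max_linorder by blast
qed

lemma L_feasible: "feasible (L S p \<gamma>)"
  and gain_le_L: "feasible Y \<Longrightarrow> gain \<gamma> Y \<le> gain \<gamma> (L S p \<gamma>)"
  using L_smallest_maximizer(1)[OF finite_ground supermodular p_not_infinity p_empty]
  unfolding is_arg_max_iff_gain by blast+

lemma L_least:
  assumes "feasible Z" "\<And>Y. feasible Y \<Longrightarrow> gain \<gamma> Y \<le> gain \<gamma> Z"
  shows "L S p \<gamma> \<subseteq> Z"
  by (rule L_smallest_maximizer(2)[OF finite_ground supermodular p_not_infinity p_empty])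
     (use assms in \<open>auto simp only: is_arg_max_iff_gain\<close>)

lemma L_subset: "L S p \<gamma> \<subseteq> S"
  by (rule feasible_subset[OF L_feasible])

text \<open>
  For \<open>\<beta> = step_value S p C - 1\<close>, the functions \<open>step_h S p C X\<close> and \<open>gain \<beta> (C \<union> X)\<close> differ
  by the constant \<open>gain \<beta> C\<close>, so a step of the iteration maximizes the same function as the
  definition of \<open>L \<beta>\<close>, but only over the supersets of \<open>C\<close>.
\<close>

lemma is_arg_max_step_h_iff_gain:
  assumes C: "feasible C"
  shows "is_arg_max (step_h S p C) (\<lambda>X. X \<subseteq> S - C) Z \<longleftrightarrow>
    Z \<subseteq> S - C \<and> feasible (C \<union> Z) \<and>
    (\<forall>Y. C \<subseteq> Y \<longrightarrow> feasible Y \<longrightarrow> gain (step_value S p C - 1) Y \<le> gain (step_value S p C - 1) (C \<union> Z))"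
    (is "?max \<longleftrightarrow> ?gain")
proof -
  let ?g = "gain (step_value S p C - 1)"
  have h: "step_h S p C X = ereal (of_int (?g (C \<union> X) - ?g C))"
    if "X \<subseteq> S - C" "feasible (C \<union> X)" for X
  proof -
    have "card (C \<union> X) = card C + card X"
      using that feasible_finite[OF that(2)] by (intro card_Un_disjoint) auto
    then show ?thesis
      by (simp add: step_h_def Un_commute[of X] p_eq_val that C gain_def algebra_simps)
  qed
  have h_inf: "step_h S p C X = - \<infinity>" if "X \<subseteq> S - C" "\<not> feasible (C \<union> X)" for X
  proof -
    have "p (X \<union> C) = - \<infinity>"
      using that feasible_subset[OF C] by (metis Diff_subset Un_commute Un_least order_trans p_infeasible)
    then show ?thesis by (simp add: step_h_def p_eq_val[OF C])
  qed
  show ?thesis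
  proof
    assume m: ?max
    have Z: "Z \<subseteq> S - C" using m by (simp add: is_arg_max_def)
    have le: "step_h S p C X \<le> step_h S p C Z" if "X \<subseteq> S - C" for X
      using m that unfolding is_arg_max_linorder by blast
    have f: "feasible (C \<union> Z)"
      using le[of "{}"] h[of "{}"] C h_inf[OF Z] by (cases "feasible (C \<union> Z)") auto
    have "?g Y \<le> ?g (C \<union> Z)" if Y: "C \<subseteq> Y" "feasible Y" for Y
    proof -
      have eq: "C \<union> (Y - C) = Y" using Y by blast
      have sub: "Y - C \<subseteq> S - C" using feasible_subset[OF Y(2)] by blast
      show ?thesis
        using le[OF sub] h[OF sub, unfolded eq, OF Y(2)] h[OF Z f] by simp
    qed
    with Z f show ?gain by blast
  next
    assume g: ?gain
    then have Z: "Z \<subseteq> S - C" "feasible (C \<union> Z)" by auto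
    have "step_h S p C X \<le> step_h S p C Z" if X: "X \<subseteq> S - C" for X
    proof (cases "feasible (C \<union> X)")
      case True
      then have "?g (C \<union> X) \<le> ?g (C \<union> Z)" using g by blast
      then show ?thesis unfolding h[OF X True] h[OF Z] by simp
    next
      case False
      then show ?thesis by (simp add: h_inf[OF X])
    qed
    then show ?max using Z unfolding is_arg_max_linorder by blast
  qed
qed

lemma step_part_subset: "feasible C \<Longrightarrow> step_part S p C \<subseteq> S - C"
  using h_smallest_maximizer(1)[OF finite_ground supermodular p_not_infinity, of C]
  by (simp add: feasible_subset p_eq_val is_arg_max_def)

section \<open>One step of the iteration\<close>

text \<open>
  Supermodularity turns the optimality of \<open>X = L \<beta>\<close> against \<open>X \<inter> Y\<close> into the bound
  \<open>p (X \<union> Y) - p Y \<ge> \<beta> card (X - Y)\<close> for \<open>Y = L \<beta>'\<close>. Since \<open>Y\<close> is optimal for \<open>\<beta>' < \<beta>\<close>, the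
  increment is also at most \<open>\<beta>' card (X - Y)\<close>, so \<open>X - Y\<close> is empty.
\<close>

lemma L_antimono:
  assumes "\<beta>' \<le> \<beta>"
  shows "L S p \<beta> \<subseteq> L S p \<beta>'"
proof (cases "\<beta>' = \<beta>")
  case False
  then have less: "\<beta>' < \<beta>" using assms by simp
  let ?X = "L S p \<beta>" and ?Y = "L S p \<beta>'"
  note sm = supermodular_val[OF L_feasible[of \<beta>] L_feasible[of \<beta>']]
  note fin = feasible_finite[OF L_feasible]
  have cI: "int (card ?X) = int (card (?X \<inter> ?Y)) + int (card (?X - ?Y))"
    using card_Int_Diff[of ?X ?Y] fin by simp
  have cU: "int (card (?X \<union> ?Y)) = int (card ?Y) + int (card (?X - ?Y))"
    using card_Un_disjoint[of ?Y "?X - ?Y"] fin by (simp add: Un_commute)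
  have "\<beta> * int (card (?X - ?Y)) \<le> \<beta>' * int (card (?X - ?Y))"
    using gain_le_L[OF sm(1), of \<beta>] gain_le_L[OF sm(2), of \<beta>'] sm(3)
    unfolding gain_def cI cU by (simp add: algebra_simps)
  then have "card (?X - ?Y) = 0" using less by (simp add: mult_le_cancel_right)
  then show ?thesis using fin by simp
qed simp

text \<open>
  Clearing the denominator \<open>card X\<close> turns the bound on the rounded quotients into the optimality
  of \<open>C\<close> among its feasible supersets; rounding is harmless because \<open>\<gamma>\<close> is an integer.
\<close>

lemma step_value_le_iff:
  assumes C: "feasible C" and ne: "C \<noteq> S"
  shows "step_value S p C \<le> \<gamma> \<longleftrightarrow> (\<forall>Y. C \<subseteq> Y \<longrightarrow> feasible Y \<longrightarrow> gain \<gamma> Y \<le> gain \<gamma> C)"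
proof -
  define q where "q X = \<lceil>real_of_ereal (p (X \<union> C) - p C) / real (card X)\<rceil>" for X
  define D where "D = {X. X \<noteq> {} \<and> X \<subseteq> S - C \<and> p (X \<union> C) \<noteq> - \<infinity>}"
  have sv: "step_value S p C = Max (q ` D)"
    unfolding step_value_def q_def D_def by (rule arg_cong[of _ _ Max]) blast
  have "D \<subseteq> Pow S" by (auto simp: D_def)
  then have "finite D" using finite_ground by (metis finite_Pow_iff finite_subset)
  moreover have "S - C \<in> D"
    using C ne p_ground by (auto simp: D_def feasible_def Un_absorb2)
  ultimately have "step_value S p C \<le> \<gamma> \<longleftrightarrow> (\<forall>X\<in>D. q X \<le> \<gamma>)"
    unfolding sv by (subst Max_le_iff) auto
  also have "\<dots> \<longleftrightarrow> (\<forall>X\<in>D. gain \<gamma> (C \<union> X) \<le> gain \<gamma> C)"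
  proof (rule ball_cong[OF refl])
    fix X assume X: "X \<in> D"
    then have f: "feasible (C \<union> X)" and disj: "C \<inter> X = {}" and "X \<noteq> {}"
      using feasible_subset[OF C] by (auto simp: D_def feasible_def Un_commute)
    have finX: "finite X" using feasible_finite[OF f] by simp
    have pos: "0 < real (card X)" using finX \<open>X \<noteq> {}\<close> by (simp add: card_gt_0_iff)
    have "q X \<le> \<gamma> \<longleftrightarrow> real_of_int (val (C \<union> X) - val C) \<le> real_of_int (\<gamma> * int (card X))"
      unfolding q_def ceiling_le_iff pos_divide_le_eq[OF pos] Un_commute[of X]
      by (simp add: p_eq_val f C)
    also have "\<dots> \<longleftrightarrow> val (C \<union> X) - val C \<le> \<gamma> * int (card X)" by (rule of_int_le_iff)
    also have "\<dots> \<longleftrightarrow> gain \<gamma> (C \<union> X) \<le> gain \<gamma> C"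
      using card_Un_disjoint[OF feasible_finite[OF C] finX disj]
      by (auto simp: gain_def algebra_simps)
    finally show "q X \<le> \<gamma> \<longleftrightarrow> gain \<gamma> (C \<union> X) \<le> gain \<gamma> C" .
  qed
  also have "\<dots> \<longleftrightarrow> (\<forall>Y. C \<subseteq> Y \<longrightarrow> feasible Y \<longrightarrow> gain \<gamma> Y \<le> gain \<gamma> C)"
  proof (intro iffI allI impI ballI)
    fix Y assume *: "\<forall>X\<in>D. gain \<gamma> (C \<union> X) \<le> gain \<gamma> C" and Y: "C \<subseteq> Y" "feasible Y"
    have eq: "C \<union> (Y - C) = Y" using Y by blast
    have "Y = C \<or> Y - C \<in> D"
      using Y by (auto simp: D_def feasible_def Un_absorb2)
    then show "gain \<gamma> Y \<le> gain \<gamma> C" using *[rule_format, of "Y - C"] eq by auto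
  next
    fix X assume "\<forall>Y. C \<subseteq> Y \<longrightarrow> feasible Y \<longrightarrow> gain \<gamma> Y \<le> gain \<gamma> C" and "X \<in> D"
    then show "gain \<gamma> (C \<union> X) \<le> gain \<gamma> C"
      using feasible_subset[OF C] by (auto simp: D_def feasible_def Un_commute)
  qed
  finally show ?thesis .
qed

text \<open>
  Since \<open>L \<gamma>\<close> is one of the supersets of \<open>C\<close>, optimality of \<open>C\<close> among these is optimality among
  all sets, and then minimality of \<open>L \<gamma>\<close> makes it equal to \<open>C\<close>.
\<close>

lemma L_eq_iff_step_value_le:
  assumes C: "feasible C" "C \<noteq> S" and sub: "C \<subseteq> L S p \<gamma>"
  shows "L S p \<gamma> = C \<longleftrightarrow> step_value S p C \<le> \<gamma>"
  unfolding step_value_le_iff[OF C]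
proof
  assume "L S p \<gamma> = C"
  then show "\<forall>Y. C \<subseteq> Y \<longrightarrow> feasible Y \<longrightarrow> gain \<gamma> Y \<le> gain \<gamma> C"
    using gain_le_L by blast
next
  assume "\<forall>Y. C \<subseteq> Y \<longrightarrow> feasible Y \<longrightarrow> gain \<gamma> Y \<le> gain \<gamma> C"
  then have "gain \<gamma> (L S p \<gamma>) \<le> gain \<gamma> C" using sub L_feasible by blast
  then have "L S p \<gamma> \<subseteq> C"
    by (intro L_least C) (use gain_le_L order_trans in blast)
  then show "L S p \<gamma> = C" using sub by blast
qed

text \<open>
  The hypothesis makes \<open>L\<close> at the step value minus one a candidate for the restricted problem of
  the step. So both problems have the same optimal value, and each smallest maximizer is contained
  in the other.
\<close>

lemma L_eq_step:
  assumes C: "feasible C" and sub: "C \<subseteq> L S p (step_value S p C - 1)"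
  shows "L S p (step_value S p C - 1) = C \<union> step_part S p C" (is "?L = _")
proof
  note h = h_smallest_maximizer[OF finite_ground supermodular p_not_infinity feasible_subset[OF C]]
  have fC: "\<bar>p C\<bar> \<noteq> \<infinity>" by (simp add: p_eq_val[OF C])
  have eq: "C \<union> (?L - C) = ?L" using sub by blast
  have part: "feasible (C \<union> step_part S p C)"
      "\<And>Y. C \<subseteq> Y \<Longrightarrow> feasible Y \<Longrightarrow>
         gain (step_value S p C - 1) Y \<le> gain (step_value S p C - 1) (C \<union> step_part S p C)"
    using h(1)[OF _ fC] unfolding is_arg_max_step_h_iff_gain[OF C] by auto
  show "?L \<subseteq> C \<union> step_part S p C"
    by (rule L_least[OF part(1)]) (use gain_le_L part(2)[OF sub L_feasible] order_trans in blast)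
  have "is_arg_max (step_h S p C) (\<lambda>X. X \<subseteq> S - C) (?L - C)"
    unfolding is_arg_max_step_h_iff_gain[OF C] eq using L_subset L_feasible gain_le_L by blast
  then have "step_part S p C \<subseteq> ?L - C" by (rule h(2)[OF _ fC, rotated])
  then show "C \<union> step_part S p C \<subseteq> ?L" using sub by blast
qed

section \<open>Following the jumps\<close>

text \<open>
  \<open>L_eq_iff_step_value_le\<close> with \<open>C = L \<beta>\<close> bounds the step value by \<open>\<beta>\<close> when used at \<open>\<gamma> = \<beta>\<close>, and
  from below by \<open>\<beta>\<close> when used at \<open>\<gamma> = \<beta> - 1\<close>, where \<open>L\<close> has changed.
\<close>

lemma step_at_jump:
  assumes "\<beta> \<in> jump_values S p"
  shows "L S p \<beta> \<subset> L S p (\<beta> - 1)" "L S p \<beta> \<noteq> S" "step_value S p (L S p \<beta>) = \<beta>"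
    "L S p (\<beta> - 1) = L S p \<beta> \<union> step_part S p (L S p \<beta>)"
proof -
  have sub: "L S p \<beta> \<subseteq> L S p (\<beta> - 1)" by (rule L_antimono) simp
  then show less: "L S p \<beta> \<subset> L S p (\<beta> - 1)" using assms by (auto simp: jump_values_def)
  then show ne: "L S p \<beta> \<noteq> S" using L_subset by blast
  show sv: "step_value S p (L S p \<beta>) = \<beta>"
    using L_eq_iff_step_value_le[OF L_feasible ne order_refl]
      L_eq_iff_step_value_le[OF L_feasible ne sub] less by auto
  show "L S p (\<beta> - 1) = L S p \<beta> \<union> step_part S p (L S p \<beta>)"
    using L_eq_step[OF L_feasible, of \<beta>] sub unfolding sv by simp
qed

text \<open>
  \<open>L\<close> grows strictly just below each jump value and never shrinks as \<open>\<beta>\<close> decreases, so distinct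
  jump values have distinct sets \<open>L \<beta>\<close>, and \<open>S\<close> has only finitely many subsets.
\<close>

lemma finite_jump_values: "finite (jump_values S p)"
proof (rule inj_on_finite)
  have "L S p \<beta> \<noteq> L S p \<beta>'" if "\<beta> < \<beta>'" "\<beta>' \<in> jump_values S p" for \<beta> \<beta>'
    using L_antimono[of \<beta> "\<beta>' - 1"] step_at_jump(1)[OF that(2)] that(1) by auto
  then show "inj_on (L S p) (jump_values S p)"
    by (metis inj_onI linorder_neqE)
  show "L S p ` jump_values S p \<subseteq> Pow S" using L_subset by blast
  show "finite (Pow S)" using finite_ground by simp
qed

text \<open>
  As long as \<open>L \<gamma>\<close> is not all of \<open>S\<close>, its step value exists and marks the next change of \<open>L\<close>. This
  is why \<open>L\<close> cannot become constant before it reaches \<open>S\<close>.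
\<close>

lemma step_value_is_jump:
  assumes "L S p \<gamma> \<noteq> S"
  shows "step_value S p (L S p \<gamma>) \<in> jump_values S p" "step_value S p (L S p \<gamma>) \<le> \<gamma>"
proof -
  let ?v = "step_value S p (L S p \<gamma>)"
  show le: "?v \<le> \<gamma>"
    using L_eq_iff_step_value_le[OF L_feasible assms order_refl] by simp
  have "L S p ?v = L S p \<gamma>" "L S p (?v - 1) \<noteq> L S p \<gamma>"
    using L_eq_iff_step_value_le[OF L_feasible assms L_antimono] le by auto
  then show "?v \<in> jump_values S p" by (simp add: jump_values_def)
qed

lemma L_last_jump:
  assumes "jump_values S p \<noteq> {}"
  shows "L S p (jump_value S p (card (jump_values S p)) - 1) = S"
proof (rule ccontr)
  let ?\<beta> = "jump_value S p (card (jump_values S p))"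
  assume "L S p (?\<beta> - 1) \<noteq> S"
  then show False
    using step_value_is_jump[of "?\<beta> - 1"] jump_value_last_le[OF finite_jump_values] by force
qed

lemma L_first_jump:
  assumes "S \<noteq> {}"
  shows "jump_values S p \<noteq> {}" "L S p (jump_value S p 1) = {}"
proof -
  let ?v = "step_value S p {}"
  have iff: "L S p \<gamma> = {} \<longleftrightarrow> ?v \<le> \<gamma>" for \<gamma>
    using L_eq_iff_step_value_le[OF feasible_empty] assms by auto
  have "L S p ?v = {}" "L S p (?v - 1) \<noteq> {}" by (simp_all add: iff)
  then have v: "?v \<in> jump_values S p" by (simp add: jump_values_def)
  then show "jump_values S p \<noteq> {}" by blast
  show "L S p (jump_value S p 1) = {}"
    unfolding iff by (rule jump_value_le_first[OF finite_jump_values v])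
qed

lemma L_next_jump:
  assumes "1 \<le> j" "j < card (jump_values S p)"
  shows "L S p (jump_value S p j - 1) = L S p (jump_value S p (Suc j))"
proof (rule L_eq_if_no_jump[symmetric])
  show "jump_value S p (Suc j) \<le> jump_value S p j - 1"
    using jump_value_strict_antimono[OF finite_jump_values assms(1), of "Suc j"] assms(2) by simp
  show "\<beta> \<notin> jump_values S p"
    if "jump_value S p (Suc j) < \<beta>" "\<beta> \<le> jump_value S p j - 1" for \<beta>
    using jump_value_gap[OF finite_jump_values assms, of \<beta>] that by auto
qed

text \<open>
  At the \<open>j\<close>-th jump value \<open>L\<close> still has the value taken on just below the previous one:
  by constancy between jumps if \<open>j > 1\<close>, and because \<open>L\<close> is empty at the largest jump value if
  \<open>j = 1\<close>.
\<close>

lemma jump_set_pred: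
  assumes "S \<noteq> {}" "1 \<le> j" "j \<le> card (jump_values S p)"
  shows "jump_set S p (j - 1) = L S p (jump_value S p j)"
proof (cases "j = 1")
  case True
  then show ?thesis using L_first_jump(2)[OF assms(1)] by (simp add: jump_set_def)
next
  case False
  then show ?thesis using L_next_jump[of "j - 1"] assms by (simp add: jump_set_def)
qed

lemma canonical_set_eq_jump_set:
  assumes "S \<noteq> {}" "j \<le> card (jump_values S p)"
  shows "canonical_set S p j = jump_set S p j"
  using assms(2)
proof (induction j)
  case 0
  show ?case by (simp add: jump_set_def)
next
  case (Suc j)
  let ?\<beta> = "jump_value S p (Suc j)"
  have "canonical_set S p j = L S p ?\<beta>"
    using Suc jump_set_pred[OF assms(1), of "Suc j"] by simp
  then have "canonical_set S p (Suc j) = L S p (?\<beta> - 1)"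
    using step_at_jump(4)[of ?\<beta>] jump_value_in[OF finite_jump_values, of "Suc j"] Suc.prems by simp
  then show ?case by (simp add: jump_set_def)
qed

lemma canonical_set_pred:
  assumes "S \<noteq> {}" "1 \<le> j" "j \<le> card (jump_values S p)"
  shows "canonical_set S p (j - 1) = L S p (jump_value S p j)"
  using canonical_set_eq_jump_set[OF assms(1), of "j - 1"] jump_set_pred[OF assms] assms(3) by simp

text \<open>After reaching \<open>S\<close> the iteration stays there, since every later part lies in \<open>S - S\<close>.\<close>

lemma canonical_set_last:
  assumes "S \<noteq> {}" "card (jump_values S p) \<le> k"
  shows "canonical_set S p k = S"
  using assms(2)
proof (induction k rule: dec_induct)
  case base
  have "1 \<le> card (jump_values S p)"
    using L_first_jump(1)[OF assms(1)] finite_jump_values by (simp add: card_gt_0_iff Suc_le_eq)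
  then show ?case
    using canonical_set_eq_jump_set[OF assms(1)] L_last_jump[OF L_first_jump(1)[OF assms(1)]]
    by (simp add: jump_set_def)
next
  case (step k)
  then show ?case using step_part_subset[OF feasible_ground] by simp
qed

lemma stopping_index_iff:
  assumes "S \<noteq> {}"
  shows "stopping_index S p k \<longleftrightarrow> k = card (jump_values S p)"
proof -
  let ?q = "card (jump_values S p)"
  have proper: "canonical_set S p (j - 1) \<noteq> S" if "1 \<le> j" "j \<le> ?q" for j
    using canonical_set_pred[OF assms that] step_at_jump(2)
      jump_value_in[OF finite_jump_values that] by simp
  have "1 \<le> ?q"
    using L_first_jump(1)[OF assms] finite_jump_values by (simp add: card_gt_0_iff Suc_le_eq)
  then have q: "stopping_index S p ?q"
    using proper[of ?q] canonical_set_last[OF assms, of ?q] by (simp add: stopping_index_def)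
  consider "k < ?q" | "k = ?q" | "?q < k" by linarith
  then show ?thesis
  proof cases
    case 1
    then show ?thesis using proper[of "Suc k"] by (auto simp: stopping_index_def)
  next
    case 2
    then show ?thesis using q by simp
  next
    case 3
    then show ?thesis
      using canonical_set_last[OF assms, of "k - 1"] by (auto simp: stopping_index_def)
  qed
qed

lemma jump_part_eq:
  assumes "S \<noteq> {}" "1 \<le> j" "j \<le> card (jump_values S p)"
  shows "jump_part S p j = L S p (jump_value S p j - 1) - L S p (jump_value S p j)"
  using jump_set_pred[OF assms] assms(2) by (simp add: jump_part_def jump_set_def)

lemma essential_value_eq:
  assumes "S \<noteq> {}" "1 \<le> j" "j \<le> card (jump_values S p)"
  shows "essential_value S p j = jump_value S p j"
  unfolding essential_value_def canonical_set_pred[OF assms]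
  by (rule step_at_jump(3)[OF jump_value_in[OF finite_jump_values assms(2,3)]])

lemma canonical_part_eq:
  assumes "S \<noteq> {}" "1 \<le> j" "j \<le> card (jump_values S p)"
  shows "canonical_part S p j = jump_part S p j"
  unfolding canonical_part_def canonical_set_pred[OF assms] jump_part_eq[OF assms]
    step_at_jump(4)[OF jump_value_in[OF finite_jump_values assms(2,3)]]
  using step_part_subset[OF L_feasible] by blast

lemma jump_part_nonempty:
  assumes "S \<noteq> {}" "1 \<le> j" "j \<le> card (jump_values S p)"
  shows "jump_part S p j \<noteq> {}"
  unfolding jump_part_eq[OF assms]
  using step_at_jump(1)[OF jump_value_in[OF finite_jump_values assms(2,3)]] by blast

lemma jump_set_strict_mono:
  assumes "S \<noteq> {}" "1 \<le> j" "j < card (jump_values S p)"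
  shows "jump_set S p j \<subset> jump_set S p (Suc j)"
  using jump_set_pred[OF assms(1), of "Suc j"] assms
    step_at_jump(1)[OF jump_value_in[OF finite_jump_values, of "Suc j"]]
  by (simp add: jump_set_def)

text \<open>The earlier part lies in \<open>L\<close> of the later jump value, which is removed from the later part.\<close>

lemma jump_part_disjoint:
  assumes "S \<noteq> {}" "1 \<le> i" "i < j" "j \<le> card (jump_values S p)"
  shows "jump_part S p i \<inter> jump_part S p j = {}"
proof -
  have "jump_value S p j \<le> jump_value S p i - 1"
    using jump_value_strict_antimono[OF finite_jump_values assms(2-4)] by simp
  then have "L S p (jump_value S p i - 1) \<subseteq> L S p (jump_value S p j)" by (rule L_antimono)
  then show ?thesis using jump_part_eq[OF assms(1)] assms by auto
qed

lemma jump_part_Union: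
  assumes "S \<noteq> {}"
  shows "\<Union>(jump_part S p ` {1..card (jump_values S p)}) = S"
proof -
  let ?q = "card (jump_values S p)"
  have "canonical_set S p j = \<Union>(jump_part S p ` {1..j})" if "j \<le> ?q" for j
    using that
  proof (induction j)
    case (Suc j)
    then have "canonical_set S p (Suc j) = canonical_set S p j \<union> jump_part S p (Suc j)"
      using canonical_part_eq[OF assms, of "Suc j"] by (simp add: canonical_part_def)
    then show ?case using Suc by (simp add: atLeastAtMostSuc_conv Un_commute)
  qed simp
  from this[of ?q] show ?thesis using canonical_set_last[OF assms, of ?q] by simp
qed

lemma jump_part_partition:
  assumes "S \<noteq> {}"
  shows "partition_on S (jump_part S p ` {1..card (jump_values S p)})"
    and "inj_on (jump_part S p) {1..card (jump_values S p)}"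
proof -
  let ?q = "card (jump_values S p)"
  have disj: "jump_part S p i \<inter> jump_part S p j = {}" if "i \<in> {1..?q}" "j \<in> {1..?q}" "i \<noteq> j" for i j
    using that jump_part_disjoint[OF assms, of i j] jump_part_disjoint[OF assms, of j i]
    by (cases "i < j") auto
  show "inj_on (jump_part S p) {1..?q}"
  proof (rule inj_onI, rule ccontr)
    fix i j assume "i \<in> {1..?q}" "j \<in> {1..?q}" "jump_part S p i = jump_part S p j" "i \<noteq> j"
    then show False using disj[of i j] jump_part_nonempty[OF assms, of j] by auto
  qed
  show "partition_on S (jump_part S p ` {1..?q})"
  proof (rule partition_onI)
    show "\<Union>(jump_part S p ` {1..?q}) = S" by (rule jump_part_Union[OF assms])
    show "{} \<notin> jump_part S p ` {1..?q}"
      using jump_part_nonempty[OF assms] by force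
    show "disjnt A B"
      if "A \<in> jump_part S p ` {1..?q}" "B \<in> jump_part S p ` {1..?q}" "A \<noteq> B" for A B
      using that disj unfolding disjnt_def by blast
  qed
qed

end

theorem proposition3p8:
  fixes S :: "'a set" and p :: "'a set \<Rightarrow> ereal"
  assumes "finite S" and "S \<noteq> {}"
    and "\<And>X. X \<subseteq> S \<Longrightarrow> p X = - \<infinity> \<or> (\<exists>k::int. p X = ereal (of_int k))"
    and "supermodular_on S p"
    and "p {} = 0" and "p S > - \<infinity>"
  shows "finite (jump_values S p) \<and>
    (let q = card (jump_values S p) in
      (\<forall>k. stopping_index S p k \<longleftrightarrow> k = q) \<and>
      (\<forall>j\<in>{1..q}. essential_value S p j = jump_value S p j) \<and>
      (\<forall>j\<in>{1..q}. canonical_set S p j = jump_set S p j) \<and>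
      (\<forall>j\<in>{1..q}. canonical_part S p j = jump_part S p j) \<and>
      (\<forall>j\<in>{1..q}. jump_part S p j = L S p (jump_value S p j - 1) - L S p (jump_value S p j)) \<and>
      (\<forall>j\<in>{1..<q}. jump_set S p j \<subset> jump_set S p (Suc j)) \<and>
      partition_on S (jump_part S p ` {1..q}) \<and> inj_on (jump_part S p) {1..q})"
proof -
  interpret integer_supermodular S p using assms by unfold_locales
  note ne = \<open>S \<noteq> {}\<close>
  show ?thesis
    using finite_jump_values stopping_index_iff[OF ne] essential_value_eq[OF ne]
      canonical_set_eq_jump_set[OF ne] canonical_part_eq[OF ne] jump_part_eq[OF ne]
      jump_set_strict_mono[OF ne] jump_part_partition[OF ne]
    unfolding Let_def by simp
qed

end
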